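(* Let $\{r,s\}=\{1,2\}$, let $F=(f_1,f_2):\Omega\subset\mathbb R^2\to\mathbb R^2$ be differentiable in the sense of Fréchet over an open set $\Omega$, and let $\mathbb A=\mathbb A^2_r(p_1,p_2)$. Then the components of $F$ satisfy on $\Omega$ the equations $$\frac{\partial f_r}{\partial x_s}=p_1\frac{\partial f_s}{\partial x_r},\qquad\frac{\partial f_s}{\partial x_s}=\frac{\partial f_r}{\partial x_r}+p_2\frac{\partial f_s}{\partial x_r}$$ if and only if $F$ is $\mathbb A$-algebrizable.
   Context: For real $p_1,p_2$, $\mathbb A^2_r(p_1,p_2)$ denotes $\mathbb R^2$ (canonical basis $e_1,e_2$) with the commutative associative product having unit $e=e_r$ and $e_se_s=p_1e_r+p_2e_s$. $F$ is $\mathbb A$-algebrizable on $\Omega$ if there is a function $F':\Omega\to\mathbb R^2$ with $\lim_{\xi\to0}|F(w+\xi)-F(w)-F'(w)\xi|/|\xi|=0$ for all $w\in\Omega$, where $F'(w)\xi$ is the product in $\mathbb A$. *)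

theory Defs
  imports "HOL-Analysis.Analysis"
begin

text \<open>The product of the algebra on the plane with unit \<open>e\<^sub>r\<close> and
  \<open>e\<^sub>s e\<^sub>s = p1 e\<^sub>r + p2 e\<^sub>s\<close>, in coordinates. The index type \<^typ>\<open>2\<close> has
  exactly two elements (its numeral 2 equals 0); meaningful for \<open>{r, s} = {1, 2}\<close>. The lemmas below
  show that this is the commutative associative product so described, and the only bilinear one.\<close>

definition alg_mult :: "2 \<Rightarrow> 2 \<Rightarrow> real \<Rightarrow> real \<Rightarrow> real^2 \<Rightarrow> real^2 \<Rightarrow> real^2" where
  "alg_mult r s p1 p2 x y =
     (x $ r * y $ r + p1 * (x $ s * y $ s)) *\<^sub>R axis r 1 +
     (x $ r * y $ s + x $ s * y $ r + p2 * (x $ s * y $ s)) *\<^sub>R axis s 1"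

definition partial_deriv :: "2 \<Rightarrow> (real^2 \<Rightarrow> real) \<Rightarrow> real^2 \<Rightarrow> real" where
  "partial_deriv j f w = deriv (\<lambda>t. f (w + t *\<^sub>R axis j 1)) 0"

text \<open>\<open>F (w + \<xi>)\<close> may be evaluated outside \<open>\<Omega>\<close>, but for open \<open>\<Omega>\<close> not in the limit.\<close>

definition algebrizable_on ::
    "(real^2 \<Rightarrow> real^2 \<Rightarrow> real^2) \<Rightarrow> (real^2 \<Rightarrow> real^2) \<Rightarrow> (real^2) set \<Rightarrow> bool" where
  "algebrizable_on m F \<Omega> \<longleftrightarrow>
     (\<exists>F' :: real^2 \<Rightarrow> real^2. \<forall>w\<in>\<Omega>.
        ((\<lambda>\<xi>. norm (F (w + \<xi>) - F w - m (F' w) \<xi>) / norm \<xi>) \<longlongrightarrow> 0) (at 0))"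

context
  fixes r s :: 2
  assumes rs: "{r, s} = {1, 2}"
begin

lemma index_neq: "r \<noteq> s"
  using rs by (auto simp: doubleton_eq_iff)

lemma index_cases: "i = r \<or> i = s"
  using rs exhaust_2[of i] by blast

lemma vec_eq_rs_iff: "x = y \<longleftrightarrow> x $ r = y $ r \<and> x $ s = (y :: real^2) $ s"
proof
  assume eq: "x $ r = y $ r \<and> x $ s = y $ s"
  have "x $ i = y $ i" for i
    using index_cases[of i] eq by (elim disjE) simp_all
  then show "x = y"
    by (simp add: vec_eq_iff)
qed simp

lemma vec_eq_rs: "x = x $ r *\<^sub>R axis r 1 + x $ s *\<^sub>R axis s (1::real)"
  using index_neq by (auto simp: vec_eq_rs_iff axis_def)

lemma alg_mult_nth:
  "alg_mult r s p1 p2 x y $ r = x $ r * y $ r + p1 * (x $ s * y $ s)"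
  "alg_mult r s p1 p2 x y $ s = x $ r * y $ s + x $ s * y $ r + p2 * (x $ s * y $ s)"
  using index_neq by (auto simp: alg_mult_def axis_def)

lemma alg_mult_commute: "alg_mult r s p1 p2 x y = alg_mult r s p1 p2 y x"
  by (simp add: vec_eq_rs_iff alg_mult_nth)

lemma alg_mult_assoc:
  "alg_mult r s p1 p2 (alg_mult r s p1 p2 x y) z = alg_mult r s p1 p2 x (alg_mult r s p1 p2 y z)"
  by (simp add: vec_eq_rs_iff alg_mult_nth algebra_simps)

lemma alg_mult_unit: "alg_mult r s p1 p2 (axis r 1) x = x"
  using index_neq by (simp add: vec_eq_rs_iff alg_mult_nth axis_def)

lemma alg_mult_square:
  "alg_mult r s p1 p2 (axis s 1) (axis s 1) = p1 *\<^sub>R axis r 1 + p2 *\<^sub>R axis s 1"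
  using index_neq by (simp add: vec_eq_rs_iff alg_mult_nth axis_def)

lemma bilinear_alg_mult: "bilinear (alg_mult r s p1 p2)"
  unfolding bilinear_def
  by (auto intro!: linearI simp: vec_eq_rs_iff alg_mult_nth algebra_simps)

lemma alg_mult_unique:
  fixes m :: "real^2 \<Rightarrow> real^2 \<Rightarrow> real^2"
  assumes bil: "bilinear m"
    and unit: "\<And>x. m (axis r 1) x = x" "\<And>x. m x (axis r 1) = x"
    and sq: "m (axis s 1) (axis s 1) = p1 *\<^sub>R axis r 1 + p2 *\<^sub>R axis s 1"
  shows "m = alg_mult r s p1 p2"
proof (intro ext)
  fix x y
  let ?er = "axis r 1 :: real^2" and ?es = "axis s 1 :: real^2"
  have "m x y = m (x $ r *\<^sub>R ?er + x $ s *\<^sub>R ?es) (y $ r *\<^sub>R ?er + y $ s *\<^sub>R ?es)"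
    by (rule arg_cong2[of _ _ _ _ m, OF vec_eq_rs[of x] vec_eq_rs[of y]])
  also have "\<dots> = (x $ r * y $ r) *\<^sub>R ?er + (x $ r * y $ s) *\<^sub>R ?es +
      (x $ s * y $ r) *\<^sub>R ?es + (x $ s * y $ s) *\<^sub>R (p1 *\<^sub>R ?er + p2 *\<^sub>R ?es)"
    by (simp only: bilinear_ladd[OF bil] bilinear_radd[OF bil] bilinear_lmul[OF bil]
        bilinear_rmul[OF bil] unit sq scaleR_scaleR scaleR_add_right add.assoc)
      (simp only: mult_ac add_ac)
  also have "\<dots> = alg_mult r s p1 p2 x y"
    using index_neq by (simp add: vec_eq_rs_iff alg_mult_nth axis_def)
  finally show "m x y = alg_mult r s p1 p2 x y" .
qed

end

end

theory Submission
  imports Defs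
begin

text \<open>
  The limit defining algebrizability says that multiplication by \<open>F' w\<close> is the Frechet
  derivative of \<open>F\<close> at \<open>w\<close>, because multiplication by a fixed element is a linear map. Since
  \<open>F\<close> is differentiable, with derivative \<open>D\<close> at \<open>w\<close> say, uniqueness of the derivative turns the
  question into linear algebra: is \<open>D\<close> multiplication by some element \<open>u\<close>? Evaluating at the unit
  \<open>e\<^sub>r\<close> forces \<open>u = D e\<^sub>r\<close>, and then only the agreement on the other basis vector,
  \<open>D e\<^sub>s = (D e\<^sub>r) e\<^sub>s\<close>, remains. The two coordinates of this equation are the two differential
  equations (lemma \<open>linear_is_alg_mult_iff\<close>), because the partial derivatives of \<open>F\<close> are the
  coordinates of \<open>D e\<^sub>r\<close> and \<open>D e\<^sub>s\<close>. The theorem thus holds pointwise, and the axiom of choice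
  collects the elements \<open>u\<close> into a function \<open>F'\<close>.
\<close>

lemma partial_deriv_eq_has_derivative:
  fixes F :: "real^2 \<Rightarrow> real^2"
  assumes "(F has_derivative D) (at w)"
  shows "partial_deriv j (\<lambda>x. F x $ i) w = D (axis j 1) $ i"
proof -
  have lin: "linear D"
    using assms by (rule has_derivative_linear)
  have line: "((\<lambda>t. w + t *\<^sub>R axis j 1) has_derivative (\<lambda>t. t *\<^sub>R axis j 1)) (at (0::real))"
    by (auto intro!: derivative_eq_intros)
  have "((\<lambda>t. F (w + t *\<^sub>R axis j 1)) has_derivative (\<lambda>t. D (t *\<^sub>R axis j 1))) (at 0)"
    using has_derivative_compose[OF line] assms by simp
  then have "((\<lambda>t. F (w + t *\<^sub>R axis j 1) $ i) has_derivative (\<lambda>t. D (t *\<^sub>R axis j 1) $ i)) (at 0)"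
    by (rule bounded_linear.has_derivative[OF bounded_linear_vec_nth])
  moreover have "(\<lambda>t. D (t *\<^sub>R axis j 1) $ i) = (*) (D (axis j 1) $ i)"
    by (simp add: linear_scale[OF lin] fun_eq_iff)
  ultimately have "((\<lambda>t. F (w + t *\<^sub>R axis j 1) $ i) has_field_derivative D (axis j 1) $ i) (at 0)"
    by (simp add: has_field_derivative_def)
  then show ?thesis
    unfolding partial_deriv_def by (rule DERIV_imp_deriv)
qed

lemma linear_alg_mult:
  assumes "{r, s} = {1, 2}"
  shows "linear (alg_mult r s p1 p2 u)"
  using bilinear_alg_mult[OF assms] unfolding bilinear_def by blast

text \<open>The Frechet derivative must also be bounded; this comes for free, because a linear map on a
  finite-dimensional space is bounded.\<close>

lemma has_derivative_alg_mult_iff: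
  assumes "{r, s} = {1, 2}"
  shows "(F has_derivative alg_mult r s p1 p2 u) (at w) \<longleftrightarrow>
    ((\<lambda>\<xi>. norm (F (w + \<xi>) - F w - alg_mult r s p1 p2 u \<xi>) / norm \<xi>) \<longlongrightarrow> 0) (at 0)"
  unfolding has_derivative_at using linear_alg_mult[OF assms] linear_conv_bounded_linear by blast

lemma algebrizable_on_iff_has_derivative:
  assumes "{r, s} = {1, 2}"
  shows "algebrizable_on (alg_mult r s p1 p2) F \<Omega> \<longleftrightarrow>
    (\<forall>w\<in>\<Omega>. \<exists>u. (F has_derivative alg_mult r s p1 p2 u) (at w))"
  unfolding algebrizable_on_def has_derivative_alg_mult_iff[OF assms] bchoice_iff ..

text \<open>The unit pins down the multiplier: if \<open>D\<close> is multiplication by \<open>u\<close>, then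
  \<open>u = u e\<^sub>r = D e\<^sub>r\<close>. So \<open>D\<close> is a multiplication precisely when it agrees with multiplication by
  \<open>D e\<^sub>r\<close> on the basis; at \<open>e\<^sub>r\<close> this is automatic, and the right-hand side below is what it says
  at \<open>e\<^sub>s\<close>.\<close>

lemma linear_is_alg_mult_iff:
  assumes rs: "{r, s} = {1, 2}" and lin: "linear D"
  shows "(\<exists>u. D = alg_mult r s p1 p2 u) \<longleftrightarrow>
    D (axis s 1) $ r = p1 * D (axis r 1) $ s \<and>
    D (axis s 1) $ s = D (axis r 1) $ r + p2 * D (axis r 1) $ s"
    (is "_ \<longleftrightarrow> ?eqs")
proof -
  let ?m = "alg_mult r s p1 p2"
  have unit: "?m u (axis r 1) = u" for u
    by (simp add: alg_mult_unit[OF rs] alg_mult_commute[OF rs, of p1 p2 u])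
  have eqs_iff: "?eqs \<longleftrightarrow> D (axis s 1) = ?m (D (axis r 1)) (axis s 1)"
    using index_neq[OF rs] by (simp add: vec_eq_rs_iff[OF rs] alg_mult_nth[OF rs] axis_def)
  show ?thesis
  proof
    assume "\<exists>u. D = ?m u"
    then show ?eqs
      unfolding eqs_iff using unit by auto
  next
    assume ?eqs
    then have at_s: "D (axis s 1) = ?m (D (axis r 1)) (axis s 1)"
      unfolding eqs_iff .
    have "D = ?m (D (axis r 1))"
    proof (rule linear_eq_stdbasis[OF lin linear_alg_mult[OF rs]])
      fix b :: "real^2"
      assume "b \<in> Basis"
      then obtain i where "b = axis i 1"
        by (auto simp: Basis_vec_def)
      then show "D b = ?m (D (axis r 1)) b"
        using index_cases[OF rs, of i] at_s unit by auto
    qed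
    then show "\<exists>u. D = ?m u" ..
  qed
qed

theorem theorem2p1:
  fixes r s :: 2
    and p1 p2 :: real
    and F :: "real^2 \<Rightarrow> real^2"
    and \<Omega> :: "(real^2) set"
  assumes "{r, s} = {1, 2}"
    and "open \<Omega>"
    and "\<forall>w\<in>\<Omega>. F differentiable (at w)"
  shows "(\<forall>w\<in>\<Omega>.
            partial_deriv s (\<lambda>x. F x $ r) w = p1 * partial_deriv r (\<lambda>x. F x $ s) w \<and>
            partial_deriv s (\<lambda>x. F x $ s) w =
              partial_deriv r (\<lambda>x. F x $ r) w + p2 * partial_deriv r (\<lambda>x. F x $ s) w)
         \<longleftrightarrow> algebrizable_on (alg_mult r s p1 p2) F \<Omega>"
proof -
  have pointwise: "(partial_deriv s (\<lambda>x. F x $ r) w = p1 * partial_deriv r (\<lambda>x. F x $ s) w \<and>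
        partial_deriv s (\<lambda>x. F x $ s) w =
          partial_deriv r (\<lambda>x. F x $ r) w + p2 * partial_deriv r (\<lambda>x. F x $ s) w)
      \<longleftrightarrow> (\<exists>u. (F has_derivative alg_mult r s p1 p2 u) (at w))" if w: "w \<in> \<Omega>" for w
  proof -
    obtain D where D: "(F has_derivative D) (at w)"
      using assms(3) w unfolding differentiable_def by blast
    have "(F has_derivative alg_mult r s p1 p2 u) (at w) \<longleftrightarrow> D = alg_mult r s p1 p2 u" for u
      using D has_derivative_unique[OF D, of "alg_mult r s p1 p2 u"] by metis
    then show ?thesis
      unfolding partial_deriv_eq_has_derivative[OF D]
      using linear_is_alg_mult_iff[OF assms(1) has_derivative_linear[OF D]] by presburger
  qed
  show ?thesis
    unfolding algebrizable_on_iff_has_derivative[OF assms(1)]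
    by (rule ball_cong[OF refl]) (rule pointwise)
qed

end
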